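(* Let $W$ be a Coxeter group with simple reflections indexed by $I$ and braid relations indexed by $J$, and let $A:=n\mathcal H(W,\mathbf d,J_0)$ be the nil-Hecke algebra for some $\mathbf d=(d_i)_{i\in I}$ with integers $2\leqslant d_i<\infty$ and some $J_0\subset J$. If $\Bbbk$ is a field of characteristic zero, then $A$ is not a bialgebra, i.e. there exist no coproduct $\Delta:A\to A\otimes A$ and counit $\varepsilon:A\to\Bbbk$ making the $\Bbbk$-algebra $A$ into a bialgebra.
   Context: A Coxeter group $W$ has a finite index set $I$ of simple reflections and a Coxeter matrix $(m_{ij})_{i,j\in I}$ with $m_{ii}=1$ and $m_{ij}=m_{ji}\in\{2,3,\dots,\infty\}$ for $i\ne j$. Let $J$ be the set of unordered pairs $\{a,b\}\subset I$, $a\neq b$, with $m_{ab}<\infty$. For $j=\{a,b\}\in J$ let $\mathbf v_j=\mathbf s_a\mathbf s_b\mathbf s_a\cdots$ and $\mathbf w_j=\mathbf s_b\mathbf s_a\mathbf s_b\cdots$ be the two alternating words with $m_{ab}$ letters each (the two sides of the braid relation for $j$). For $J_0\subset J$ and $\mathbf d=(d_i)_{i\in I}$ with integers $d_i\geqslant 2$, the nil-Hecke algebra $n\mathcal H(W,\mathbf d,J_0)$ is the associative unital $\Bbbk$-algebra generated by $\{\mathbf s_i:i\in I\}$ with relations $$\mathbf s_i^{d_i}=0\ (i\in I),\qquad \mathbf v_j=\mathbf w_j\ (j\in J_0),\qquad \mathbf v_j=0=\mathbf w_j\ (j\in J\setminus J_0).$$ *)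

theory Defs
  imports "HOL-Library.Poly_Mapping" "HOL-Library.Extended_Nat" "HOL-Algebra.Module" "HOL-Algebra.QuotRing"
begin

section \<open>Algebras over a field\<close>

definition ground :: "('k::field, 'k) module" where
  "ground = \<lparr>carrier = UNIV, mult = (*), one = 1, zero = 0, add = (+), smult = (*)\<rparr>"

text \<open>Associative unital algebras. The library's locale \<^locale>\<open>algebra\<close> is restricted to
  commutative ones.\<close>

locale k_algebra = ring A + vs: Module.module ground A
  for A :: "('k::field, 'a) module" (structure) +
  assumes smult_mult_left:
      "\<lbrakk>x \<in> carrier A; y \<in> carrier A\<rbrakk> \<Longrightarrow> (c \<odot> x) \<otimes> y = c \<odot> (x \<otimes> y)"
    and smult_mult_right:
      "\<lbrakk>x \<in> carrier A; y \<in> carrier A\<rbrakk> \<Longrightarrow> x \<otimes> (c \<odot> y) = c \<odot> (x \<otimes> y)"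

definition algebra_hom ::
    "('k::field, 'a) module \<Rightarrow> ('k, 'b) module \<Rightarrow> ('a \<Rightarrow> 'b) set" where
  "algebra_hom A B =
     {h \<in> ring_hom A B. \<forall>c. \<forall>x \<in> carrier A. h (c \<odot>\<^bsub>A\<^esub> x) = c \<odot>\<^bsub>B\<^esub> h x}"

text \<open>The quotient of an algebra by a two-sided ideal \<open>J\<close>; its elements are the cosets of \<open>J\<close>.\<close>

definition quot_algebra ::
    "('k::field, 'a) module \<Rightarrow> 'a set \<Rightarrow> ('k, 'a set) module" where
  "quot_algebra A J =
     ring.extend (A Quot J)
       (module.fields (\<lambda>c X. \<Union>x\<in>X. J +>\<^bsub>A\<^esub> (c \<odot>\<^bsub>A\<^esub> x)))"

definition monoid_algebra ::
    "('g, 'm) monoid_scheme \<Rightarrow> ('k::field, 'g \<Rightarrow>\<^sub>0 'k) module" where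
  "monoid_algebra G =
     \<lparr>carrier = {p. Poly_Mapping.keys p \<subseteq> carrier G},
      mult = (\<lambda>p q. \<Sum>x\<in>Poly_Mapping.keys p. \<Sum>y\<in>Poly_Mapping.keys q.
        Poly_Mapping.single (x \<otimes>\<^bsub>G\<^esub> y) (Poly_Mapping.lookup p x * Poly_Mapping.lookup q y)),
      one = Poly_Mapping.single \<one>\<^bsub>G\<^esub> 1,
      zero = 0,
      add = (+),
      smult = (\<lambda>c. Poly_Mapping.map ((*) c))\<rparr>"

section \<open>Tensor products\<close>

text \<open>The vector space \<open>A \<otimes> B\<close> is the free vector space on \<^term>\<open>carrier A \<times> carrier B\<close> modulo
  the subspace that forces bilinearity. The product of \<^term>\<open>monoid_algebra (A \<times>\<times> B)\<close> is
  \<open>(a, b) (a', b') = (a a', b b')\<close> on basis elements, so the quotient carries the usual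
  product of a tensor product of algebras.\<close>

definition tensor_relators ::
    "('k::field, 'a) module \<Rightarrow> ('k, 'b) module \<Rightarrow> ('a \<times> 'b \<Rightarrow>\<^sub>0 'k) set" where
  "tensor_relators A B =
     {Poly_Mapping.single (a \<oplus>\<^bsub>A\<^esub> a', b) 1 - Poly_Mapping.single (a, b) 1
        - Poly_Mapping.single (a', b) 1 |
        a a' b. a \<in> carrier A \<and> a' \<in> carrier A \<and> b \<in> carrier B} \<union>
     {Poly_Mapping.single (a, b \<oplus>\<^bsub>B\<^esub> b') 1 - Poly_Mapping.single (a, b) 1
        - Poly_Mapping.single (a, b') 1 |
        a b b'. a \<in> carrier A \<and> b \<in> carrier B \<and> b' \<in> carrier B} \<union>
     {Poly_Mapping.single (c \<odot>\<^bsub>A\<^esub> a, b) 1 - Poly_Mapping.single (a, b) c |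
        c a b. a \<in> carrier A \<and> b \<in> carrier B} \<union>
     {Poly_Mapping.single (a, c \<odot>\<^bsub>B\<^esub> b) 1 - Poly_Mapping.single (a, b) c |
        c a b. a \<in> carrier A \<and> b \<in> carrier B}"

definition tensor_null ::
    "('k::field, 'a) module \<Rightarrow> ('k, 'b) module \<Rightarrow> ('a \<times> 'b \<Rightarrow>\<^sub>0 'k) set" where
  "tensor_null A B =
     (\<lambda>H. submodule H ground (monoid_algebra (A \<times>\<times> B))) hull tensor_relators A B"

definition tensor ::
    "('k::field, 'a) module \<Rightarrow> ('k, 'b) module \<Rightarrow> ('k, ('a \<times> 'b \<Rightarrow>\<^sub>0 'k) set) module" where
  "tensor A B = quot_algebra (monoid_algebra (A \<times>\<times> B)) (tensor_null A B)"

definition pure_tensor ::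
    "('k::field, 'a) module \<Rightarrow> ('k, 'b) module \<Rightarrow> 'a \<Rightarrow> 'b \<Rightarrow> ('a \<times> 'b \<Rightarrow>\<^sub>0 'k) set" where
  "pure_tensor A B a b =
     tensor_null A B +>\<^bsub>monoid_algebra (A \<times>\<times> B)\<^esub> Poly_Mapping.single (a, b) 1"

text \<open>The linear map from a tensor product to \<open>M\<close> induced by a bilinear map \<open>\<beta>\<close>:
  all elements of the coset \<open>X\<close> have the same image under the linear extension of \<open>\<beta>\<close>.\<close>

definition tensor_lift ::
    "('k::field, 'c) module \<Rightarrow> ('a \<Rightarrow> 'b \<Rightarrow> 'c) \<Rightarrow> ('a \<times> 'b \<Rightarrow>\<^sub>0 'k) set \<Rightarrow> 'c" where
  "tensor_lift M \<beta> X =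
     the_elem ((\<lambda>p. \<Oplus>\<^bsub>M\<^esub>z\<in>Poly_Mapping.keys p.
       Poly_Mapping.lookup p z \<odot>\<^bsub>M\<^esub> \<beta> (fst z) (snd z)) ` X)"

text \<open>The map \<open>f \<otimes> g\<close> with values in \<open>C \<otimes> D\<close>.\<close>

definition tensor_map ::
    "('k::field, 'c) module \<Rightarrow> ('k, 'd) module \<Rightarrow> ('a \<Rightarrow> 'c) \<Rightarrow> ('b \<Rightarrow> 'd) \<Rightarrow>
     ('a \<times> 'b \<Rightarrow>\<^sub>0 'k) set \<Rightarrow> ('c \<times> 'd \<Rightarrow>\<^sub>0 'k) set" where
  "tensor_map C D f g = tensor_lift (tensor C D) (\<lambda>a b. pure_tensor C D (f a) (g b))"

text \<open>The canonical map \<open>(A \<otimes> B) \<otimes> C \<rightarrow> A \<otimes> (B \<otimes> C)\<close>.\<close>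

definition tensor_assoc ::
    "('k::field, 'a) module \<Rightarrow> ('k, 'b) module \<Rightarrow> ('k, 'c) module \<Rightarrow>
     (('a \<times> 'b \<Rightarrow>\<^sub>0 'k) set \<times> 'c \<Rightarrow>\<^sub>0 'k) set \<Rightarrow>
     ('a \<times> ('b \<times> 'c \<Rightarrow>\<^sub>0 'k) set \<Rightarrow>\<^sub>0 'k) set" where
  "tensor_assoc A B C =
     tensor_lift (tensor A (tensor B C))
       (\<lambda>t c. tensor_lift (tensor A (tensor B C))
          (\<lambda>a b. pure_tensor A (tensor B C) a (pure_tensor B C b c)) t)"

section \<open>Bialgebras\<close>

text \<open>In the counit laws, \<open>\<Bbbk> \<otimes> A\<close> and \<open>A \<otimes> \<Bbbk>\<close> are identified with \<open>A\<close>.\<close>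

locale bialgebra = k_algebra A
  for A :: "('k::field, 'a) module" (structure)
    and \<Delta> :: "'a \<Rightarrow> ('a \<times> 'a \<Rightarrow>\<^sub>0 'k) set"
    and \<epsilon> :: "'a \<Rightarrow> 'k" +
  assumes comult_hom: "\<Delta> \<in> algebra_hom A (tensor A A)"
    and counit_hom: "\<epsilon> \<in> algebra_hom A ground"
    and coassoc: "x \<in> carrier A \<Longrightarrow>
      tensor_assoc A A A (tensor_map (tensor A A) A \<Delta> id (\<Delta> x)) =
      tensor_map A (tensor A A) id \<Delta> (\<Delta> x)"
    and counit_left: "x \<in> carrier A \<Longrightarrow> tensor_lift A (\<lambda>a b. \<epsilon> a \<odot> b) (\<Delta> x) = x"
    and counit_right: "x \<in> carrier A \<Longrightarrow> tensor_lift A (\<lambda>a b. \<epsilon> b \<odot> a) (\<Delta> x) = x"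

section \<open>Nil-Hecke algebras\<close>

definition coxeter_matrix :: "('i \<Rightarrow> 'i \<Rightarrow> enat) \<Rightarrow> bool" where
  "coxeter_matrix m \<longleftrightarrow>
     (\<forall>i. m i i = 1) \<and> (\<forall>i j. i \<noteq> j \<longrightarrow> m i j = m j i \<and> 2 \<le> m i j)"

definition braid_pairs :: "('i \<Rightarrow> 'i \<Rightarrow> enat) \<Rightarrow> 'i set set" where
  "braid_pairs m = {{a, b} | a b. a \<noteq> b \<and> m a b < \<infinity>}"

definition free_monoid :: "'i list monoid" where
  "free_monoid = \<lparr>carrier = UNIV, mult = (@), one = []\<rparr>"

definition free_algebra :: "('k::field, 'i list \<Rightarrow>\<^sub>0 'k) module" where
  "free_algebra = monoid_algebra free_monoid"

definition word :: "'i list \<Rightarrow> 'i list \<Rightarrow>\<^sub>0 'k::field" where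
  "word w = Poly_Mapping.single w 1"

primrec alternating :: "nat \<Rightarrow> 'i \<Rightarrow> 'i \<Rightarrow> 'i list" where
  "alternating 0 a b = []"
| "alternating (Suc n) a b = a # alternating n b a"

text \<open>One side of the braid relation for \<open>{a, b}\<close>; the other side is \<open>braid_word m b a\<close>.\<close>

definition braid_word :: "('i \<Rightarrow> 'i \<Rightarrow> enat) \<Rightarrow> 'i \<Rightarrow> 'i \<Rightarrow> 'i list \<Rightarrow>\<^sub>0 'k::field" where
  "braid_word m a b = word (alternating (the_enat (m a b)) a b)"

text \<open>Since \<open>{a, b} = {b, a}\<close>, the last set contains both sides of each braid relation
  outside \<open>J\<^sub>0\<close>.\<close>

definition nil_hecke_relators ::
    "('i \<Rightarrow> 'i \<Rightarrow> enat) \<Rightarrow> ('i \<Rightarrow> nat) \<Rightarrow> 'i set set \<Rightarrow> ('i list \<Rightarrow>\<^sub>0 'k::field) set" where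
  "nil_hecke_relators m d J\<^sub>0 =
     {word [i] [^]\<^bsub>free_algebra\<^esub> d i | i. True} \<union>
     {braid_word m a b - braid_word m b a | a b. {a, b} \<in> J\<^sub>0} \<union>
     {braid_word m a b | a b. {a, b} \<in> braid_pairs m - J\<^sub>0}"

definition nil_hecke ::
    "('i \<Rightarrow> 'i \<Rightarrow> enat) \<Rightarrow> ('i \<Rightarrow> nat) \<Rightarrow> 'i set set \<Rightarrow>
     ('k::field, ('i list \<Rightarrow>\<^sub>0 'k) set) module" where
  "nil_hecke m d J\<^sub>0 =
     quot_algebra free_algebra (Idl\<^bsub>free_algebra\<^esub> (nil_hecke_relators m d J\<^sub>0))"

end

theory Submission
  imports Defs
begin

text \<open>
  The obstruction is visible on a single generator \<open>s = s\<^sub>i\<close>. Since \<open>s\<^sup>d = 0\<close> with \<open>d = d\<^sub>i\<close>, every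
  counit kills all generators, so it is the augmentation of \<open>A\<close>. Each side of a braid relation
  contains two different generators; hence sending \<open>s\<close> to \<open>x\<close> and the other generators to \<open>0\<close>
  defines an algebra map \<open>\<pi> : A \<rightarrow> \<Bbbk>[x]/(x\<^sup>d)\<close>, compatible with the augmentations. Let \<open>c\<^sub>n\<close> be
  its coefficient functionals. Then \<open>c\<^sub>0 = \<epsilon>\<close>, and \<open>\<delta> = c\<^sub>1\<close> satisfies
  \<open>\<delta>(xy) = \<epsilon>(x) \<delta>(y) + \<delta>(x) \<epsilon>(y)\<close>, because \<open>d \<ge> 2\<close>.

  Suppose that \<open>A\<close> is a bialgebra and put \<open>E = (id \<otimes> \<delta>) \<Delta> : A \<rightarrow> A\<close>. As \<open>\<Delta>\<close> is multiplicative,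
  the right counit law makes \<open>E\<close> a derivation of \<open>A\<close>, and the left counit law gives
  \<open>\<epsilon> E = \<delta>\<close>, so \<open>\<pi>(E s)\<close> has constant term \<open>\<delta>(s) = 1\<close>. Therefore
  \<open>0 = \<pi>(E(s\<^sup>d)) = d x\<^bsup>d-1\<^esup> \<pi>(E s) = d x\<^bsup>d-1\<^esup>\<close> in \<open>\<Bbbk>[x]/(x\<^sup>d)\<close>, which is impossible in
  characteristic zero. This argument is \<open>truncated_character_power_nonzero\<close>, stated for any
  bialgebra with such a family \<open>c\<close>.

  The rest supplies its ingredients. On the side of tensor products, a bilinear map extends to
  cosets independently of the representative (\<open>tensor_lift_eq\<close>), so that functionals can be
  evaluated on \<open>\<Delta> x\<close> through any representative of it, and products of representatives
  represent \<open>\<Delta> (x y)\<close> (\<open>comult_mult_rep\<close>). On the side of the nil-Hecke algebra, the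
  functionals \<open>c\<^sub>n\<close> are well defined because the elements of the free algebra without powers
  \<open>s\<^sup>n\<close>, \<open>n < d\<close>, form an ideal that contains all relators (\<open>ideal_no_small_powers\<close>,
  \<open>relators_no_small_powers\<close>).
\<close>

section \<open>Linear extension of functions on a basis\<close>

definition lin_ext :: "('a \<Rightarrow> 'k) \<Rightarrow> ('a \<Rightarrow>\<^sub>0 'k::field) \<Rightarrow> 'k" where
  "lin_ext \<phi> p = (\<Sum>x\<in>Poly_Mapping.keys p. Poly_Mapping.lookup p x * \<phi> x)"

lemma lin_ext_superset:
  assumes "finite S" "Poly_Mapping.keys p \<subseteq> S"
  shows "lin_ext \<phi> p = (\<Sum>x\<in>S. Poly_Mapping.lookup p x * \<phi> x)"
  unfolding lin_ext_def
  by (rule sum.mono_neutral_left) (use assms in \<open>auto simp: in_keys_iff\<close>)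

lemma lin_ext_cong:
  "(\<And>x. x \<in> Poly_Mapping.keys p \<Longrightarrow> \<phi> x = \<psi> x) \<Longrightarrow> lin_ext \<phi> p = lin_ext \<psi> p"
  by (simp add: lin_ext_def)

lemma lin_ext_add: "lin_ext \<phi> (p + q) = lin_ext \<phi> p + lin_ext \<phi> q"
proof -
  let ?S = "Poly_Mapping.keys p \<union> Poly_Mapping.keys q"
  have "Poly_Mapping.keys (p + q) \<subseteq> ?S" by (rule keys_add)
  then show ?thesis
    by (simp add: lin_ext_superset[of ?S] lookup_add distrib_right sum.distrib)
qed

lemma lin_ext_single [simp]: "lin_ext \<phi> (Poly_Mapping.single x c) = c * \<phi> x"
  by (simp add: lin_ext_def)

lemma lin_ext_sum: "lin_ext \<phi> (\<Sum>i\<in>T. p i) = (\<Sum>i\<in>T. lin_ext \<phi> (p i))"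
  by (induction T rule: infinite_finite_induct) (simp_all add: lin_ext_add lin_ext_def[of _ 0])

lemma lookup_scale: "Poly_Mapping.lookup (Poly_Mapping.map ((*) c) p) x = c * Poly_Mapping.lookup p x"
  for c :: "'k::field"
  by (simp add: Poly_Mapping.map.rep_eq when_def)

lemma keys_scale: "Poly_Mapping.keys (Poly_Mapping.map ((*) c) p) \<subseteq> Poly_Mapping.keys p"
  for c :: "'k::field"
  by (auto simp: in_keys_iff lookup_scale)

lemma lookup_eq_lin_ext: "Poly_Mapping.lookup p w = lin_ext (\<lambda>x. of_bool (x = w)) p"
proof -
  have "lin_ext (\<lambda>x. of_bool (x = w)) p =
      (\<Sum>x\<in>insert w (Poly_Mapping.keys p). Poly_Mapping.lookup p x * of_bool (x = w))"
    by (rule lin_ext_superset) auto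
  also have "\<dots> = (\<Sum>x\<in>insert w (Poly_Mapping.keys p). if x = w then Poly_Mapping.lookup p x else 0)"
    by (rule sum.cong) auto
  also have "\<dots> = Poly_Mapping.lookup p w" by (subst sum.delta) auto
  finally show ?thesis by simp
qed

text \<open>Identities between elements of monoid algebras are proved by comparing all functionals on
  them: on products these unfold to iterated extensions, which avoids manipulating double sums
  of basis elements.\<close>

lemma poly_mapping_eq_if_lin_ext:
  assumes "\<And>\<phi>. lin_ext \<phi> p = lin_ext \<phi> q"
  shows "p = q"
  by (rule poly_mapping_eqI) (simp add: lookup_eq_lin_ext assms)

lemma lin_ext_unique:
  assumes additive: "\<And>p q. f (p + q) = f p + f q"
    and single: "\<And>w c. f (Poly_Mapping.single w c) = c * f (Poly_Mapping.single w 1)"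
  shows "f p = lin_ext (\<lambda>w. f (Poly_Mapping.single w 1)) p"
proof -
  have "f (\<Sum>w\<in>S. Poly_Mapping.single w (Poly_Mapping.lookup p w)) =
      (\<Sum>w\<in>S. Poly_Mapping.lookup p w * f (Poly_Mapping.single w 1))" if "finite S" for S
    using that
  proof (induction S rule: finite_induct)
    case empty
    then show ?case using single[of undefined 0] by simp
  next
    case (insert w S)
    then show ?case
      by (simp only: sum.insert not_False_eq_True additive single[of w "Poly_Mapping.lookup p w"])
  qed
  moreover have "(\<Sum>w\<in>Poly_Mapping.keys p. Poly_Mapping.single w (Poly_Mapping.lookup p w)) = p"
    by (rule poly_mapping_eq_if_lin_ext) (simp add: lin_ext_sum, simp add: lin_ext_def)
  ultimately show ?thesis by (metis finite_keys lin_ext_def)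
qed


section \<open>Monoid algebras\<close>

lemma carrier_monoid_algebra [simp]:
    "carrier (monoid_algebra G) = {p. Poly_Mapping.keys p \<subseteq> carrier G}"
  and zero_monoid_algebra [simp]: "\<zero>\<^bsub>monoid_algebra G\<^esub> = 0"
  and one_monoid_algebra [simp]: "\<one>\<^bsub>monoid_algebra G\<^esub> = Poly_Mapping.single \<one>\<^bsub>G\<^esub> 1"
  and add_monoid_algebra [simp]: "p \<oplus>\<^bsub>monoid_algebra G\<^esub> q = p + q"
  and smult_monoid_algebra [simp]: "c \<odot>\<^bsub>monoid_algebra G\<^esub> p = Poly_Mapping.map ((*) c) p"
  by (simp_all add: monoid_algebra_def)

lemma mult_monoid_algebra:
  "p \<otimes>\<^bsub>monoid_algebra G\<^esub> q =
     (\<Sum>x\<in>Poly_Mapping.keys p. \<Sum>y\<in>Poly_Mapping.keys q.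
        Poly_Mapping.single (x \<otimes>\<^bsub>G\<^esub> y) (Poly_Mapping.lookup p x * Poly_Mapping.lookup q y))"
  by (simp add: monoid_algebra_def)

lemma lin_ext_mult:
  "lin_ext \<phi> (p \<otimes>\<^bsub>monoid_algebra G\<^esub> q) = lin_ext (\<lambda>x. lin_ext (\<lambda>y. \<phi> (x \<otimes>\<^bsub>G\<^esub> y)) q) p"
  by (simp add: mult_monoid_algebra lin_ext_sum) (simp add: lin_ext_def sum_distrib_left mult.assoc)

text \<open>A function on the monoid with a finite coproduct formula induces a functional with the same
  formula on the monoid algebra. This is used twice: for the coefficients of powers in the free
  algebra, and for the functionals \<open>c\<^sub>n \<otimes> c\<^sub>1\<close> on a tensor square.\<close>

lemma lin_ext_mult_split:
  assumes "\<And>x y. x \<in> Poly_Mapping.keys p \<Longrightarrow> y \<in> Poly_Mapping.keys q \<Longrightarrow>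
    \<phi> (x \<otimes>\<^bsub>G\<^esub> y) = (\<Sum>t\<in>T. \<psi> t x * \<chi> t y)"
  shows "lin_ext \<phi> (p \<otimes>\<^bsub>monoid_algebra G\<^esub> q) = (\<Sum>t\<in>T. lin_ext (\<psi> t) p * lin_ext (\<chi> t) q)"
proof -
  have "lin_ext \<phi> (p \<otimes>\<^bsub>monoid_algebra G\<^esub> q) =
      (\<Sum>x\<in>Poly_Mapping.keys p. \<Sum>y\<in>Poly_Mapping.keys q. \<Sum>t\<in>T.
        (Poly_Mapping.lookup p x * \<psi> t x) * (Poly_Mapping.lookup q y * \<chi> t y))"
    unfolding lin_ext_mult unfolding lin_ext_def
    by (intro sum.cong refl) (simp add: assms sum_distrib_left mult_ac)
  also have "\<dots> = (\<Sum>x\<in>Poly_Mapping.keys p. \<Sum>t\<in>T. \<Sum>y\<in>Poly_Mapping.keys q.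
        (Poly_Mapping.lookup p x * \<psi> t x) * (Poly_Mapping.lookup q y * \<chi> t y))"
    by (rule sum.cong[OF refl]) (rule sum.swap)
  also have "\<dots> = (\<Sum>t\<in>T. lin_ext (\<psi> t) p * lin_ext (\<chi> t) q)"
    by (subst sum.swap) (simp add: lin_ext_def sum_product)
  finally show ?thesis .
qed

lemma keys_mult_monoid_algebra:
  "Poly_Mapping.keys (p \<otimes>\<^bsub>monoid_algebra G\<^esub> q) \<subseteq>
     {x \<otimes>\<^bsub>G\<^esub> y | x y. x \<in> Poly_Mapping.keys p \<and> y \<in> Poly_Mapping.keys q}"
proof
  fix z assume z: "z \<in> Poly_Mapping.keys (p \<otimes>\<^bsub>monoid_algebra G\<^esub> q)"
  show "z \<in> {x \<otimes>\<^bsub>G\<^esub> y | x y. x \<in> Poly_Mapping.keys p \<and> y \<in> Poly_Mapping.keys q}"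
  proof (rule ccontr)
    assume "\<not> ?thesis"
    then have "Poly_Mapping.lookup (p \<otimes>\<^bsub>monoid_algebra G\<^esub> q) z = 0"
      unfolding lookup_eq_lin_ext[of _ z] lin_ext_mult unfolding lin_ext_def
      by (intro sum.neutral ballI) (auto intro!: sum.neutral)
    with z show False by (simp add: in_keys_iff)
  qed
qed

lemma mult_single_monoid_algebra [simp]:
  "Poly_Mapping.single x b \<otimes>\<^bsub>monoid_algebra G\<^esub> Poly_Mapping.single y c =
     Poly_Mapping.single (x \<otimes>\<^bsub>G\<^esub> y) (b * c)"
  by (rule poly_mapping_eq_if_lin_ext) (simp add: lin_ext_mult)

text \<open>The additive structure is treated apart from the product, since \<^const>\<open>tensor_null\<close> is a subspace
  of a monoid algebra whose factors may be mere modules.\<close>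

lemma abelian_group_monoid_algebra: "abelian_group (monoid_algebra G)"
proof (rule abelian_groupI)
  fix p assume "p \<in> carrier (monoid_algebra G)"
  then show "\<exists>q\<in>carrier (monoid_algebra G). q \<oplus>\<^bsub>monoid_algebra G\<^esub> p = \<zero>\<^bsub>monoid_algebra G\<^esub>"
    by (intro bexI[of _ "- p"]) auto
qed (use keys_add in \<open>fastforce simp: add_ac\<close>)+

lemma a_inv_monoid_algebra [simp]:
  assumes "Poly_Mapping.keys p \<subseteq> carrier G"
  shows "\<ominus>\<^bsub>monoid_algebra G\<^esub> p = - p"
proof -
  interpret abelian_group "monoid_algebra G" by (rule abelian_group_monoid_algebra)
  show ?thesis by (rule minus_equality) (use assms in auto)
qed

lemma ring_monoid_algebra:
  fixes G :: "('g, 'm) monoid_scheme"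
  assumes "monoid G"
  shows "ring (monoid_algebra G :: ('k::field, 'g \<Rightarrow>\<^sub>0 'k) module)"
proof -
  let ?R = "monoid_algebra G :: ('k, 'g \<Rightarrow>\<^sub>0 'k) module"
  interpret G: monoid G by (rule assms)
  have "monoid ?R"
  proof (rule monoidI)
    fix p q assume "p \<in> carrier ?R" "q \<in> carrier ?R"
    then show "p \<otimes>\<^bsub>?R\<^esub> q \<in> carrier ?R"
      using keys_mult_monoid_algebra[of G p q] by fastforce
  next
    fix p q r
    assume "p \<in> carrier ?R" "q \<in> carrier ?R"
      "r \<in> carrier ?R"
    then show "(p \<otimes>\<^bsub>?R\<^esub> q) \<otimes>\<^bsub>?R\<^esub> r =
        p \<otimes>\<^bsub>?R\<^esub> (q \<otimes>\<^bsub>?R\<^esub> r)"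
      by (intro poly_mapping_eq_if_lin_ext)
        (auto simp: lin_ext_mult G.m_assoc subset_iff intro!: lin_ext_cong)
  next
    fix p assume "p \<in> carrier ?R"
    then have "lin_ext (\<lambda>x. \<phi> (\<one>\<^bsub>G\<^esub> \<otimes>\<^bsub>G\<^esub> x)) p = lin_ext \<phi> p"
      and "lin_ext (\<lambda>x. \<phi> (x \<otimes>\<^bsub>G\<^esub> \<one>\<^bsub>G\<^esub>)) p = lin_ext \<phi> p" for \<phi>
      by (auto intro!: lin_ext_cong)
    then show "\<one>\<^bsub>?R\<^esub> \<otimes>\<^bsub>?R\<^esub> p = p"
      and "p \<otimes>\<^bsub>?R\<^esub> \<one>\<^bsub>?R\<^esub> = p"
      by (auto intro!: poly_mapping_eq_if_lin_ext simp: lin_ext_mult)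
  qed auto
  moreover have "lin_ext (\<lambda>x. \<phi> x + \<psi> x) p = lin_ext \<phi> p + lin_ext \<psi> p"
    for \<phi> \<psi> and p :: "'g \<Rightarrow>\<^sub>0 'k"
    by (simp add: lin_ext_def distrib_left sum.distrib)
  ultimately show ?thesis
    by (intro ringI abelian_group_monoid_algebra poly_mapping_eq_if_lin_ext)
      (simp_all add: lin_ext_mult lin_ext_add)
qed

section \<open>Linear maps out of tensor products\<close>

lemma ground_simps [simp]:
  "carrier ground = UNIV" "x \<otimes>\<^bsub>ground\<^esub> y = x * y" "\<one>\<^bsub>ground\<^esub> = 1" "\<zero>\<^bsub>ground\<^esub> = 0"
  "x \<oplus>\<^bsub>ground\<^esub> y = x + y" "x \<odot>\<^bsub>ground\<^esub> y = x * y"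
  by (simp_all add: ground_def)

text \<open>The canonical linear map from a free vector space determined by the images \<open>\<beta>\<close> of basis
  elements. Only the values of \<open>\<beta>\<close> on a subset \<open>Z\<close> of the basis lie in the module in general, so
  linearity is proved for elements supported in \<open>Z\<close>.\<close>

definition module_ext ::
    "('k::field, 'c) module \<Rightarrow> ('z \<Rightarrow> 'c) \<Rightarrow> ('z \<Rightarrow>\<^sub>0 'k) \<Rightarrow> 'c" where
  "module_ext M \<beta> p =
     (\<Oplus>\<^bsub>M\<^esub>z\<in>Poly_Mapping.keys p. Poly_Mapping.lookup p z \<odot>\<^bsub>M\<^esub> \<beta> z)"

locale ground_module = M: Module.module ground M for M :: "('k::field, 'c) module" (structure)
begin

context
  fixes \<beta> :: "'z \<Rightarrow> 'c" and Z :: "'z set"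
  assumes \<beta>: "\<beta> \<in> Z \<rightarrow> carrier M"
begin

lemma smult_closed_family: "z \<in> Z \<Longrightarrow> c \<odot> \<beta> z \<in> carrier M"
  using \<beta> by (intro M.smult_closed) auto

lemma module_ext_closed: "Poly_Mapping.keys p \<subseteq> Z \<Longrightarrow> module_ext M \<beta> p \<in> carrier M"
  unfolding module_ext_def using smult_closed_family by (intro M.M.finsum_closed) (auto simp: subset_iff)

lemma module_ext_superset:
  assumes "finite S" "Poly_Mapping.keys p \<subseteq> S" "S \<subseteq> Z"
  shows "module_ext M \<beta> p = (\<Oplus>z\<in>S. Poly_Mapping.lookup p z \<odot> \<beta> z)"
  unfolding module_ext_def
proof (rule M.M.add.finprod_mono_neutral_cong_left)
  fix z assume "z \<in> S - Poly_Mapping.keys p"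
  then show "Poly_Mapping.lookup p z \<odot> \<beta> z = \<zero>"
    using assms \<beta> M.smult_l_null[of "\<beta> z"] by (auto simp: in_keys_iff)
qed (use assms smult_closed_family in \<open>auto simp: subset_iff\<close>)

lemma module_ext_add:
  assumes "Poly_Mapping.keys p \<subseteq> Z" "Poly_Mapping.keys q \<subseteq> Z"
  shows "module_ext M \<beta> (p + q) = module_ext M \<beta> p \<oplus> module_ext M \<beta> q"
proof -
  let ?S = "Poly_Mapping.keys p \<union> Poly_Mapping.keys q"
  have "module_ext M \<beta> (p + q) = (\<Oplus>z\<in>?S. Poly_Mapping.lookup (p + q) z \<odot> \<beta> z)"
    using assms keys_add[of p q] by (intro module_ext_superset) auto
  also have "\<dots> = (\<Oplus>z\<in>?S. Poly_Mapping.lookup p z \<odot> \<beta> z \<oplus> Poly_Mapping.lookup q z \<odot> \<beta> z)"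
  proof (rule M.M.finsum_cong')
    fix z assume "z \<in> ?S"
    then show "Poly_Mapping.lookup (p + q) z \<odot> \<beta> z =
        Poly_Mapping.lookup p z \<odot> \<beta> z \<oplus> Poly_Mapping.lookup q z \<odot> \<beta> z"
      using M.smult_l_distr[of "Poly_Mapping.lookup p z" "Poly_Mapping.lookup q z" "\<beta> z"] \<beta> assms
      by (auto simp: lookup_add)
  qed (use smult_closed_family assms in \<open>auto simp: subset_iff\<close>)
  also have "\<dots> = (\<Oplus>z\<in>?S. Poly_Mapping.lookup p z \<odot> \<beta> z) \<oplus> (\<Oplus>z\<in>?S. Poly_Mapping.lookup q z \<odot> \<beta> z)"
    by (rule M.M.finsum_addf) (use smult_closed_family assms in \<open>auto simp: subset_iff\<close>)
  also have "\<dots> = module_ext M \<beta> p \<oplus> module_ext M \<beta> q"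
    using assms by (simp add: module_ext_superset[of ?S])
  finally show ?thesis .
qed

lemma module_ext_diff:
  assumes "Poly_Mapping.keys p \<subseteq> Z" "Poly_Mapping.keys q \<subseteq> Z"
  shows "module_ext M \<beta> (p - q) = module_ext M \<beta> p \<ominus> module_ext M \<beta> q"
proof -
  have k: "Poly_Mapping.keys (p - q) \<subseteq> Z" using keys_diff[of p q] assms by auto
  have "module_ext M \<beta> p = module_ext M \<beta> (p - q) \<oplus> module_ext M \<beta> q"
    using module_ext_add[OF k assms(2)] by simp
  then show ?thesis
    using module_ext_closed k assms by (simp add: a_minus_def M.M.a_assoc M.M.r_neg)
qed

lemma module_ext_scale:
  assumes "Poly_Mapping.keys p \<subseteq> Z"
  shows "module_ext M \<beta> (Poly_Mapping.map ((*) c) p) = c \<odot> module_ext M \<beta> p"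
proof -
  have "module_ext M \<beta> (Poly_Mapping.map ((*) c) p) =
      (\<Oplus>z\<in>Poly_Mapping.keys p. Poly_Mapping.lookup (Poly_Mapping.map ((*) c) p) z \<odot> \<beta> z)"
    using assms keys_scale[of c p] by (intro module_ext_superset) auto
  also have "\<dots> = (\<Oplus>z\<in>Poly_Mapping.keys p. c \<odot> (Poly_Mapping.lookup p z \<odot> \<beta> z))"
  proof (rule M.M.finsum_cong')
    fix z assume "z \<in> Poly_Mapping.keys p"
    then show "Poly_Mapping.lookup (Poly_Mapping.map ((*) c) p) z \<odot> \<beta> z =
        c \<odot> (Poly_Mapping.lookup p z \<odot> \<beta> z)"
      using M.smult_assoc1[of c "Poly_Mapping.lookup p z" "\<beta> z"] \<beta> assms
      by (auto simp: lookup_scale)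
  qed (use smult_closed_family assms in \<open>auto simp: subset_iff\<close>)
  also have "\<dots> = c \<odot> module_ext M \<beta> p"
    unfolding module_ext_def by (rule M.finsum_smult_ldistr[symmetric])
      (use smult_closed_family assms in \<open>auto simp: subset_iff\<close>)
  finally show ?thesis .
qed

lemma module_ext_single: "z \<in> Z \<Longrightarrow> module_ext M \<beta> (Poly_Mapping.single z c) = c \<odot> \<beta> z"
  using module_ext_superset[of "{z}" "Poly_Mapping.single z c"] smult_closed_family[of z c]
  by (auto simp: M.M.finsum_insert Pi_iff split: if_splits)

end

lemma linear_module_ext:
  fixes f :: "'c \<Rightarrow> 'k"
  assumes add: "\<And>x y. x \<in> carrier M \<Longrightarrow> y \<in> carrier M \<Longrightarrow> f (x \<oplus> y) = f x + f y"
    and smult: "\<And>c x. x \<in> carrier M \<Longrightarrow> f (c \<odot> x) = c * f x"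
    and \<beta>: "\<beta> \<in> Z \<rightarrow> carrier M" and p: "Poly_Mapping.keys p \<subseteq> Z"
  shows "f (module_ext M \<beta> p) = lin_ext (\<lambda>z. f (\<beta> z)) p"
proof -
  have "f \<zero> = f \<zero> + f \<zero>"
    using add[of \<zero> \<zero>] by (simp only: M.M.zero_closed M.M.l_zero)
  then have f0: "f \<zero> = 0" by (simp only: add_cancel_right_right)
  have "f (\<Oplus>z\<in>S. Poly_Mapping.lookup p z \<odot> \<beta> z) = (\<Sum>z\<in>S. Poly_Mapping.lookup p z * f (\<beta> z))"
    if "finite S" "S \<subseteq> Z" for S
    using that
  proof (induction S rule: finite_induct)
    case (insert z S)
    have "(\<Oplus>z\<in>insert z S. Poly_Mapping.lookup p z \<odot> \<beta> z) =
        Poly_Mapping.lookup p z \<odot> \<beta> z \<oplus> (\<Oplus>z\<in>S. Poly_Mapping.lookup p z \<odot> \<beta> z)"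
      by (rule M.M.finsum_insert) (use insert smult_closed_family[OF \<beta>] in \<open>auto simp: subset_iff\<close>)
    moreover have "(\<Oplus>z\<in>S. Poly_Mapping.lookup p z \<odot> \<beta> z) \<in> carrier M"
      by (rule M.M.finsum_closed) (use insert smult_closed_family[OF \<beta>] in \<open>auto simp: subset_iff\<close>)
    moreover have "\<beta> z \<in> carrier M" using insert \<beta> by auto
    ultimately show ?case using insert by (simp add: add smult)
  qed (simp add: f0)
  then show ?thesis using p by (simp add: module_ext_def lin_ext_def)
qed

end

lemma quot_algebra_simps:
  "carrier (quot_algebra R J) = a_rcosets\<^bsub>R\<^esub> J"
  "X \<otimes>\<^bsub>quot_algebra R J\<^esub> Y = rcoset_mult R J X Y"
  "\<one>\<^bsub>quot_algebra R J\<^esub> = J +>\<^bsub>R\<^esub> \<one>\<^bsub>R\<^esub>"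
  "\<zero>\<^bsub>quot_algebra R J\<^esub> = J"
  "X \<oplus>\<^bsub>quot_algebra R J\<^esub> Y = X <+>\<^bsub>R\<^esub> Y"
  "c \<odot>\<^bsub>quot_algebra R J\<^esub> X = (\<Union>x\<in>X. J +>\<^bsub>R\<^esub> (c \<odot>\<^bsub>R\<^esub> x))"
  by (simp_all add: quot_algebra_def FactRing_def ring.extend_def module.fields_def ring.defs module.defs)

lemma tensor_carrierE:
  assumes "X \<in> carrier (tensor A B)"
  obtains p where "Poly_Mapping.keys p \<subseteq> carrier A \<times> carrier B"
    and "X = {h + p | h. h \<in> tensor_null A B}"
  using assms
  by (auto simp: tensor_def quot_algebra_simps A_RCOSETS_def' a_r_coset_def')

lemma zero_in_tensor_null: "0 \<in> tensor_null A B"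
  unfolding tensor_null_def hull_def
proof clarsimp
  fix t assume "submodule t ground (monoid_algebra (A \<times>\<times> B))"
  then interpret submodule t ground "monoid_algebra (A \<times>\<times> B)" .
  show "0 \<in> t" using one_closed by simp
qed

locale ground_bilinear = ground_module M for M :: "('k::field, 'c) module" (structure) +
  fixes A :: "('k, 'a) module" and B :: "('k, 'b) module" and \<beta> :: "'a \<Rightarrow> 'b \<Rightarrow> 'c"
  assumes A: "Module.module ground A" and B: "Module.module ground B"
    and closed: "\<And>a b. a \<in> carrier A \<Longrightarrow> b \<in> carrier B \<Longrightarrow> \<beta> a b \<in> carrier M"
    and addl: "\<And>a a' b. a \<in> carrier A \<Longrightarrow> a' \<in> carrier A \<Longrightarrow> b \<in> carrier B \<Longrightarrow>
      \<beta> (a \<oplus>\<^bsub>A\<^esub> a') b = \<beta> a b \<oplus> \<beta> a' b"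
    and addr: "\<And>a b b'. a \<in> carrier A \<Longrightarrow> b \<in> carrier B \<Longrightarrow> b' \<in> carrier B \<Longrightarrow>
      \<beta> a (b \<oplus>\<^bsub>B\<^esub> b') = \<beta> a b \<oplus> \<beta> a b'"
    and smultl: "\<And>c a b. a \<in> carrier A \<Longrightarrow> b \<in> carrier B \<Longrightarrow> \<beta> (c \<odot>\<^bsub>A\<^esub> a) b = c \<odot> \<beta> a b"
    and smultr: "\<And>c a b. a \<in> carrier A \<Longrightarrow> b \<in> carrier B \<Longrightarrow> \<beta> a (c \<odot>\<^bsub>B\<^esub> b) = c \<odot> \<beta> a b"
begin

text \<open>Bilinearity of \<open>\<beta>\<close> says exactly that its linear extension kills the relators; since the kernel
  is a subspace, it contains everything that they span.\<close>

lemma tensor_null_subset_kernel: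
  "tensor_null A B \<subseteq> {p. Poly_Mapping.keys p \<subseteq> carrier A \<times> carrier B \<and>
    module_ext M (\<lambda>z. \<beta> (fst z) (snd z)) p = \<zero>}" (is "_ \<subseteq> ?K")
proof -
  interpret A: Module.module ground A by (rule A)
  interpret B: Module.module ground B by (rule B)
  let ?Z = "carrier A \<times> carrier B" and ?\<beta> = "\<lambda>z. \<beta> (fst z) (snd z)"
  have \<beta>: "?\<beta> \<in> ?Z \<rightarrow> carrier M" using closed by auto
  have one: "1 \<odot> x = x" if "x \<in> carrier M" for x using M.smult_one[OF that] by simp
  have smA: "c \<odot>\<^bsub>A\<^esub> a \<in> carrier A" if "a \<in> carrier A" for a c
    using A.smult_closed that by simp
  have smB: "c \<odot>\<^bsub>B\<^esub> a \<in> carrier B" if "a \<in> carrier B" for a c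
    using B.smult_closed that by simp
  have sm: "c \<odot> a \<in> carrier M" if "a \<in> carrier M" for a c
    using M.smult_closed that by simp
  have keys1: "Poly_Mapping.keys (Poly_Mapping.single z c) \<subseteq> ?Z"
    if "z \<in> ?Z" for z and c :: 'k using that by auto
  have keysm: "Poly_Mapping.keys (p - q) \<subseteq> ?Z"
    if "Poly_Mapping.keys p \<subseteq> ?Z" "Poly_Mapping.keys q \<subseteq> ?Z" for p q :: "_ \<Rightarrow>\<^sub>0 'k"
    using that keys_diff[of p q] by auto
  note [simp] = module_ext_diff[OF \<beta>] module_ext_single[OF \<beta>] keys1 keysm
  have cancel2: "(x \<oplus> y) \<ominus> x \<ominus> y = \<zero>" if "x \<in> carrier M" "y \<in> carrier M" for x y
    using that M.M.r_neg[of "x \<oplus> y"] by (simp add: a_minus_def M.M.a_assoc M.M.minus_add)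
  have cancel1: "x \<ominus> x = \<zero>" if "x \<in> carrier M" for x
    using that by (simp add: a_minus_def M.M.r_neg)
  have "tensor_relators A B \<subseteq> ?K"
  proof
    fix p assume "p \<in> tensor_relators A B"
    then show "p \<in> ?K"
      unfolding tensor_relators_def
      by (elim UnE CollectE exE conjE)
        (simp_all del: keys_single add: closed one addl addr smultl smultr sm smA smB cancel1 cancel2)
  qed
  moreover have "submodule ?K ground (monoid_algebra (A \<times>\<times> B))"
  proof unfold_locales
    fix p q assume p: "p \<in> ?K" and q: "q \<in> ?K"
    then show "p \<otimes>\<^bsub>add_monoid (monoid_algebra (A \<times>\<times> B))\<^esub> q \<in> ?K"
      using keys_add[of p q] by (auto simp: module_ext_add[OF \<beta>])
    have "inv\<^bsub>add_monoid (monoid_algebra (A \<times>\<times> B))\<^esub> p = - p"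
      using a_inv_monoid_algebra[of p "A \<times>\<times> B"] p by (auto simp: a_inv_def)
    moreover have "module_ext M ?\<beta> (0 - p) = \<zero>"
      using p module_ext_closed[OF \<beta>, of p]
      by (subst module_ext_diff[OF \<beta>]) (auto simp: module_ext_def a_minus_def)
    ultimately show "inv\<^bsub>add_monoid (monoid_algebra (A \<times>\<times> B))\<^esub> p \<in> ?K"
      using p by auto
  next
    fix c :: 'k and p assume "p \<in> ?K"
    then show "c \<odot>\<^bsub>monoid_algebra (A \<times>\<times> B)\<^esub> p \<in> ?K"
      using keys_scale[of c p] M.smult_r_null[of c] by (auto simp: module_ext_scale[OF \<beta>])
  qed (auto simp: module_ext_def)
  ultimately show ?thesis
    unfolding tensor_null_def by (rule hull_minimal)
qed

text \<open>Two representatives of a coset differ by an element of the kernel, so the set of values in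
  the definition of \<^const>\<open>tensor_lift\<close> is a singleton.\<close>

lemma tensor_lift_eq:
  assumes X: "X \<in> carrier (tensor A B)" and p: "p \<in> X"
  shows "Poly_Mapping.keys p \<subseteq> carrier A \<times> carrier B"
    and "tensor_lift M \<beta> X = module_ext M (\<lambda>z. \<beta> (fst z) (snd z)) p"
proof -
  let ?Z = "carrier A \<times> carrier B" and ?\<beta> = "\<lambda>z. \<beta> (fst z) (snd z)"
  have \<beta>: "?\<beta> \<in> ?Z \<rightarrow> carrier M" using closed by auto
  obtain q where q: "Poly_Mapping.keys q \<subseteq> ?Z" and Xq: "X = {h + q | h. h \<in> tensor_null A B}"
    using X by (rule tensor_carrierE)
  have rep: "Poly_Mapping.keys r \<subseteq> ?Z \<and> module_ext M ?\<beta> r = module_ext M ?\<beta> q"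
    if rX: "r \<in> X" for r
  proof -
    obtain h where h: "h \<in> tensor_null A B" and r: "r = h + q" using rX Xq by auto
    have "Poly_Mapping.keys h \<subseteq> ?Z" "module_ext M ?\<beta> h = \<zero>"
      using tensor_null_subset_kernel h by auto
    with q r show ?thesis
      using keys_add[of h q] module_ext_closed[OF \<beta> q] by (auto simp: module_ext_add[OF \<beta>])
  qed
  show "Poly_Mapping.keys p \<subseteq> ?Z" using rep p by blast
  have "module_ext M ?\<beta> ` X = {module_ext M ?\<beta> p}" using rep p by auto
  then show "tensor_lift M \<beta> X = module_ext M ?\<beta> p"
    by (simp add: tensor_lift_def module_ext_def)
qed

end

section \<open>Truncated characters on a bialgebra\<close>

definition linear_functional :: "('k::field, 'a) module \<Rightarrow> ('a \<Rightarrow> 'k) \<Rightarrow> bool" where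
  "linear_functional A f \<longleftrightarrow>
     (\<forall>x\<in>carrier A. \<forall>y\<in>carrier A. f (x \<oplus>\<^bsub>A\<^esub> y) = f x + f y) \<and>
     (\<forall>c. \<forall>x\<in>carrier A. f (c \<odot>\<^bsub>A\<^esub> x) = c * f x)"

lemma (in k_algebra) ground_module_axioms: "ground_module A"
  by (intro ground_module.intro vs.module_axioms)

context bialgebra
begin

interpretation V: ground_module A by (rule ground_module_axioms)

lemma comult_carrier: "x \<in> carrier A \<Longrightarrow> \<Delta> x \<in> carrier (tensor A A)"
  using comult_hom by (auto simp: algebra_hom_def ring_hom_def)

lemma comult_nonempty: "x \<in> carrier A \<Longrightarrow> \<exists>p. p \<in> \<Delta> x"
  by (rule tensor_carrierE[OF comult_carrier]) (use zero_in_tensor_null in blast)+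

text \<open>By the definition of \<^const>\<open>rcoset_mult\<close>, the product of two cosets of a subspace is a union of
  cosets, and it contains the products of their elements because the subspace contains \<open>0\<close>.\<close>

lemma comult_mult_rep:
  assumes "x \<in> carrier A" "y \<in> carrier A" "p \<in> \<Delta> x" "q \<in> \<Delta> y"
  shows "p \<otimes>\<^bsub>monoid_algebra (A \<times>\<times> A)\<^esub> q \<in> \<Delta> (x \<otimes> y)"
proof -
  have "\<Delta> (x \<otimes> y) = \<Delta> x \<otimes>\<^bsub>tensor A A\<^esub> \<Delta> y"
    using comult_hom assms by (auto simp: algebra_hom_def ring_hom_def)
  also have "\<dots> = rcoset_mult (monoid_algebra (A \<times>\<times> A)) (tensor_null A A) (\<Delta> x) (\<Delta> y)"
    by (simp add: tensor_def quot_algebra_simps)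
  finally show ?thesis
    using assms(3,4) zero_in_tensor_null[of A A] by (force simp: rcoset_mult_def a_r_coset_def')
qed

text \<open>This turns the counit laws, which are equations in the algebra, into equations between values
  of functionals on a representative of \<open>\<Delta> x\<close>: the left-hand sides are \<open>f ((id \<otimes> g) \<Delta> x)\<close> and
  \<open>f ((g \<otimes> id) \<Delta> x)\<close>.\<close>

lemma functional_comult:
  assumes f: "linear_functional A f" and g: "linear_functional A g"
    and x: "x \<in> carrier A" and p: "p \<in> \<Delta> x"
  shows "Poly_Mapping.keys p \<subseteq> carrier A \<times> carrier A"
    and "f (tensor_lift A (\<lambda>a b. g b \<odot> a) (\<Delta> x)) = lin_ext (\<lambda>z. f (fst z) * g (snd z)) p"
    and "f (tensor_lift A (\<lambda>a b. g a \<odot> b) (\<Delta> x)) = lin_ext (\<lambda>z. g (fst z) * f (snd z)) p"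
proof -
  have M: "Module.module ground A" by (rule vs.module_axioms)
  have ld: "(a + b) \<odot> v = a \<odot> v \<oplus> b \<odot> v" if "v \<in> carrier A" for a b v
    using vs.smult_l_distr[of a b v] that by simp
  have rd: "a \<odot> (v \<oplus> w) = a \<odot> v \<oplus> a \<odot> w" if "v \<in> carrier A" "w \<in> carrier A" for a v w
    using vs.smult_r_distr[of a v w] that by simp
  have as: "(a * b) \<odot> v = a \<odot> (b \<odot> v)" if "v \<in> carrier A" for a b v
    using vs.smult_assoc1[of a b v] that by simp
  have as': "b \<odot> (a \<odot> v) = a \<odot> (b \<odot> v)" if "v \<in> carrier A" for a b v
    using as[OF that, of a b] as[OF that, of b a] by (simp add: mult.commute)
  have cl: "a \<odot> v \<in> carrier A" if "v \<in> carrier A" for a v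
    using vs.smult_closed that by simp
  note G = g[unfolded linear_functional_def] and F = f[unfolded linear_functional_def]
  have "ground_bilinear A A A (\<lambda>a b. g b \<odot> a)" and "ground_bilinear A A A (\<lambda>a b. g a \<odot> b)"
    by (intro ground_bilinear.intro V.ground_module_axioms ground_bilinear_axioms.intro M;
        simp add: ld rd as as' cl G)+
  note eq = this[THEN ground_bilinear.tensor_lift_eq(2), OF comult_carrier[OF x] p]
    and eqk = this(1)[THEN ground_bilinear.tensor_lift_eq(1), OF comult_carrier[OF x] p]
  note eqk
  moreover have "f (module_ext A (\<lambda>z. g (snd z) \<odot> fst z) p) = lin_ext (\<lambda>z. f (fst z) * g (snd z)) p"
    if "Poly_Mapping.keys p \<subseteq> carrier A \<times> carrier A"
    using that
    by (subst V.linear_module_ext[of f _ "carrier A \<times> carrier A"])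
      (auto simp: F cl mult.commute intro!: lin_ext_cong)
  moreover have "f (module_ext A (\<lambda>z. g (fst z) \<odot> snd z) p) = lin_ext (\<lambda>z. g (fst z) * f (snd z)) p"
    if "Poly_Mapping.keys p \<subseteq> carrier A \<times> carrier A"
    using that
    by (subst V.linear_module_ext[of f _ "carrier A \<times> carrier A"])
      (auto simp: F cl intro!: lin_ext_cong)
  ultimately show "Poly_Mapping.keys p \<subseteq> carrier A \<times> carrier A"
    and "f (tensor_lift A (\<lambda>a b. g b \<odot> a) (\<Delta> x)) = lin_ext (\<lambda>z. f (fst z) * g (snd z)) p"
    and "f (tensor_lift A (\<lambda>a b. g a \<odot> b) (\<Delta> x)) = lin_ext (\<lambda>z. g (fst z) * f (snd z)) p"
    by (simp_all add: eq)
qed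

lemma counit_linear: "linear_functional A \<epsilon>"
  using counit_hom by (auto simp: algebra_hom_def ring_hom_def linear_functional_def)

text \<open>The family \<open>c\<close> is an algebra map to \<open>\<Bbbk>[x]/(x\<^sup>d)\<close> over the augmentation, written in coefficients,
  and \<open>s\<close> is an element that it sends to \<open>x\<close>. Read coefficientwise, the map
  \<open>E = (id \<otimes> c\<^sub>1) \<Delta>\<close> is a derivation, and \<open>E s\<close> has constant term \<open>1\<close>; so the coefficient of
  \<open>x\<^bsup>d-1\<^esup>\<close> in \<open>E (s\<^sup>d)\<close> is \<open>d\<close>.\<close>

theorem truncated_character_power_nonzero:
  fixes c :: "nat \<Rightarrow> 'a \<Rightarrow> 'k"
  assumes linear: "\<And>n. n < d \<Longrightarrow> linear_functional A (c n)"
    and c0: "\<And>x. x \<in> carrier A \<Longrightarrow> c 0 x = \<epsilon> x"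
    and conv: "\<And>n x y. n < d \<Longrightarrow> x \<in> carrier A \<Longrightarrow> y \<in> carrier A \<Longrightarrow>
      c n (x \<otimes> y) = (\<Sum>k\<le>n. c k x * c (n - k) y)"
    and s: "s \<in> carrier A" and cs: "\<And>n. n < d \<Longrightarrow> c n s = of_bool (n = 1)"
    and d: "2 \<le> d" "(of_nat d :: 'k) \<noteq> 0"
  shows "s [^] d \<noteq> \<zero>"
proof
  define E where "E x = tensor_lift A (\<lambda>a b. c 1 b \<odot> a) (\<Delta> x)" for x
  have E: "c n (E x) = lin_ext (\<lambda>z. c n (fst z) * c 1 (snd z)) p"
    if "n < d" "x \<in> carrier A" "p \<in> \<Delta> x" for n x p
    unfolding E_def using that d linear by (intro functional_comult(2)) auto
  have keys: "Poly_Mapping.keys p \<subseteq> carrier A \<times> carrier A" if "x \<in> carrier A" "p \<in> \<Delta> x" for x p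
    by (rule functional_comult(1)[OF counit_linear counit_linear that])
  \<comment> \<open>The right counit law for \<open>c\<^sub>0 = \<epsilon>\<close>.\<close>
  have c0': "lin_ext (\<lambda>z. c n (fst z) * c 0 (snd z)) p = c n x"
    if n: "n < d" and x: "x \<in> carrier A" and p: "p \<in> \<Delta> x" for n x p
  proof -
    have "lin_ext (\<lambda>z. c n (fst z) * c 0 (snd z)) p = lin_ext (\<lambda>z. c n (fst z) * \<epsilon> (snd z)) p"
      using keys[OF x p] by (intro lin_ext_cong) (auto simp: c0)
    also have "\<dots> = c n x"
      using functional_comult(2)[OF linear[OF n] counit_linear x p] counit_right[OF x] by simp
    finally show ?thesis .
  qed
  \<comment> \<open>The left counit law: \<open>\<epsilon> E = c\<^sub>1\<close>.\<close>
  have E0: "c 0 (E x) = c 1 x" if x: "x \<in> carrier A" for x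
  proof -
    obtain p where p: "p \<in> \<Delta> x" using comult_nonempty[OF x] by blast
    have "c 0 (E x) = lin_ext (\<lambda>z. c 0 (fst z) * c 1 (snd z)) p"
      using E[OF _ x p] d by simp
    also have "\<dots> = lin_ext (\<lambda>z. \<epsilon> (fst z) * c 1 (snd z)) p"
      using keys[OF x p] by (intro lin_ext_cong) (auto simp: c0)
    also have "\<dots> = c 1 x"
      using functional_comult(3)[OF linear counit_linear x p] counit_left[OF x] d by simp
    finally show ?thesis .
  qed
  \<comment> \<open>The sum over \<open>l \<le> 1\<close> that arises from \<open>c\<^sub>1\<close> of a product has two terms, and in each of them
     one of the factors is \<open>c\<^sub>0\<close>; the right counit law removes it.\<close>
  have derivation: "c n (E (x \<otimes> y)) =
      (\<Sum>k\<le>n. c k x * c (n - k) (E y)) + (\<Sum>k\<le>n. c k (E x) * c (n - k) y)"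
    if n: "n < d" and x: "x \<in> carrier A" and y: "y \<in> carrier A" for n x y
  proof -
    obtain p where p: "p \<in> \<Delta> x" using comult_nonempty[OF x] by blast
    obtain q where q: "q \<in> \<Delta> y" using comult_nonempty[OF y] by blast
    have "c n (E (x \<otimes> y)) = lin_ext (\<lambda>z. c n (fst z) * c 1 (snd z)) (p \<otimes>\<^bsub>monoid_algebra (A \<times>\<times> A)\<^esub> q)"
      using E[OF n _ comult_mult_rep[OF x y p q]] x y by simp
    also have "\<dots> = (\<Sum>(k, l)\<in>{..n} \<times> {..1}.
        lin_ext (\<lambda>z. c k (fst z) * c l (snd z)) p *
        lin_ext (\<lambda>z. c (n - k) (fst z) * c (1 - l) (snd z)) q)"
      unfolding case_prod_beta
    proof (rule lin_ext_mult_split)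
      fix z w assume "z \<in> Poly_Mapping.keys p" "w \<in> Poly_Mapping.keys q"
      then have "z \<in> carrier A \<times> carrier A" "w \<in> carrier A \<times> carrier A"
        using keys[OF x p] keys[OF y q] by auto
      then have "c n (fst (z \<otimes>\<^bsub>A \<times>\<times> A\<^esub> w)) * c 1 (snd (z \<otimes>\<^bsub>A \<times>\<times> A\<^esub> w)) =
          (\<Sum>k\<le>n. c k (fst z) * c (n - k) (fst w)) * (\<Sum>l\<le>1. c l (snd z) * c (1 - l) (snd w))"
        using n d by (auto simp: conv DirProd_def)
      then show "c n (fst (z \<otimes>\<^bsub>A \<times>\<times> A\<^esub> w)) * c 1 (snd (z \<otimes>\<^bsub>A \<times>\<times> A\<^esub> w)) =
          (\<Sum>t\<in>{..n} \<times> {..1}. (c (fst t) (fst z) * c (snd t) (snd z)) *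
            (c (n - fst t) (fst w) * c (1 - snd t) (snd w)))"
        by (simp only: sum_product sum.cartesian_product case_prod_unfold mult_ac)
    qed
    also have "\<dots> = (\<Sum>k\<le>n. c k x * c (n - k) (E y) + c k (E x) * c (n - k) y)"
      unfolding sum.cartesian_product[symmetric]
      by (rule sum.cong) (use n d in \<open>simp_all add: c0'[OF _ x p] c0'[OF _ y q] E[OF _ x p] E[OF _ y q]\<close>)
    finally show ?thesis by (simp add: sum.distrib)
  qed
  have delta: "(\<Sum>k\<le>n. of_bool (k = j) * F k) = (if j \<le> n then F j else 0)" for n j :: nat and F :: "nat \<Rightarrow> 'k"
    by (simp add: of_bool_def if_distrib[of "\<lambda>u. u * _"] sum.delta cong: if_cong)
  have cpow: "c n (s [^] Suc k) = of_bool (n = Suc k)" if "n < d" for n k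
    using that
  proof (induction k arbitrary: n)
    case (Suc k)
    have "c n (s [^] Suc (Suc k)) = (\<Sum>j\<le>n. c j (s [^] Suc k) * c (n - j) s)"
      using conv[OF Suc.prems, of "s [^] Suc k" s] s by simp
    also have "\<dots> = (\<Sum>j\<le>n. of_bool (j = Suc k) * of_bool (n - j = 1))"
      using Suc by (intro sum.cong) (auto simp: cs)
    also have "\<dots> = of_bool (n = Suc (Suc k))" by (subst delta) auto
    finally show ?case .
  qed (use s cs in simp)
  \<comment> \<open>The coefficient of \<open>x\<^sup>k\<close> in \<open>(k + 1) x\<^sup>k (E s)\<close>: a step of the induction adds the constant
     term of \<open>E s\<close>.\<close>
  have Epow: "c k (E (s [^] Suc k)) = of_nat (Suc k)" if "k < d" for k
    using that
  proof (induction k)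
    case 0
    then show ?case using E0 s cs d by simp
  next
    case (Suc k)
    have "c (Suc k) (E (s [^] Suc (Suc k))) =
        (\<Sum>j\<le>Suc k. c j (s [^] Suc k) * c (Suc k - j) (E s)) +
        (\<Sum>j\<le>Suc k. c j (E (s [^] Suc k)) * c (Suc k - j) s)"
      using derivation[OF Suc.prems, of "s [^] Suc k" s] s by simp
    also have "(\<Sum>j\<le>Suc k. c j (s [^] Suc k) * c (Suc k - j) (E s)) =
        (\<Sum>j\<le>Suc k. of_bool (j = Suc k) * c (Suc k - j) (E s))"
      using Suc.prems by (intro sum.cong refl arg_cong2[of _ _ _ _ "(*)"] cpow) auto
    also have "\<dots> = c 0 (E s)" by (subst delta) simp
    also have "(\<Sum>j\<le>Suc k. c j (E (s [^] Suc k)) * c (Suc k - j) s) =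
        (\<Sum>j\<le>Suc k. of_bool (j = k) * c j (E (s [^] Suc k)))"
      using Suc.prems by (intro sum.cong) (auto simp: cs)
    also have "\<dots> = c k (E (s [^] Suc k))" by (subst delta) simp
    finally show ?case using Suc E0[OF s] cs d by simp
  qed
  assume "s [^] d = \<zero>"
  obtain k where k: "d = Suc k" using d by (cases d) auto
  have "of_nat d = c k (E \<zero>)"
    using Epow[of k] k \<open>s [^] d = \<zero>\<close> by simp
  also have "\<dots> = 0"
  proof -
    have "c k (E \<zero>) = (\<Sum>j\<le>k. c j \<zero> * c (k - j) (E \<zero>)) + (\<Sum>j\<le>k. c j (E \<zero>) * c (k - j) \<zero>)"
      using derivation[of k \<zero> \<zero>] k by simp
    moreover have "c j \<zero> = 0" if "j < d" for j
    proof -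
      have "c j (0 \<odot> \<zero>) = 0 * c j \<zero>"
        using linear[OF that] zero_closed unfolding linear_functional_def by blast
      then show ?thesis using vs.smult_l_null[of \<zero>] by simp
    qed
    ultimately show ?thesis using k by simp
  qed
  finally show False using d by simp
qed

end


section \<open>Quotients of algebras\<close>

context
  fixes R :: "('k::field, 'a) module" (structure) and J :: "'a set"
  assumes J: "ideal J R"
begin

interpretation ideal J R by (rule J)

lemma quot_algebra_eq_coset:
  assumes "X \<in> carrier (quot_algebra R J)" "x \<in> X"
  shows "X = J +> x"
proof -
  obtain y where y: "y \<in> carrier R" "X = J +> y"
    using assms(1) by (auto simp: quot_algebra_simps A_RCOSETS_def')
  then show ?thesis using a_repr_independence[OF _ y(1) a_subgroup] assms(2) by blast
qed

lemma coset_in_quot_algebra: "x \<in> carrier R \<Longrightarrow> J +> x \<in> carrier (quot_algebra R J)"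
  by (simp add: quot_algebra_simps a_rcosetsI a_subset)

lemma quot_algebra_ex_rep: "X \<in> carrier (quot_algebra R J) \<Longrightarrow> \<exists>x. x \<in> X"
  using a_rcos_self by (auto simp: quot_algebra_simps A_RCOSETS_def')

lemma quot_algebra_smult_rep:
  assumes "x \<in> X" "c \<odot> x \<in> carrier R"
  shows "c \<odot> x \<in> c \<odot>\<^bsub>quot_algebra R J\<^esub> X"
  unfolding quot_algebra_simps by (rule UN_I[OF assms(1)]) (rule a_rcos_self[OF assms(2)])

lemma coset_ring_hom: "(+>) J \<in> ring_hom R (quot_algebra R J)"
  using rcos_ring_hom by (simp add: ring_hom_def FactRing_def quot_algebra_simps)

end

section \<open>Powers of a generator in a nil-Hecke algebra\<close>

lemma ring_free_algebra: "ring (free_algebra :: ('k::field, 'i list \<Rightarrow>\<^sub>0 'k) module)"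
  unfolding free_algebra_def
  by (intro ring_monoid_algebra monoidI) (auto simp: free_monoid_def)

lemma free_monoid_simps [simp]:
  "carrier free_monoid = UNIV" "u \<otimes>\<^bsub>free_monoid\<^esub> v = u @ v" "\<one>\<^bsub>free_monoid\<^esub> = []"
  by (simp_all add: free_monoid_def)

lemma free_algebra_simps [simp]:
  "carrier free_algebra = UNIV" "\<zero>\<^bsub>free_algebra\<^esub> = 0" "\<one>\<^bsub>free_algebra\<^esub> = word []"
  "p \<oplus>\<^bsub>free_algebra\<^esub> q = p + q" "c \<odot>\<^bsub>free_algebra\<^esub> p = Poly_Mapping.map ((*) c) p"
  "word u \<otimes>\<^bsub>free_algebra\<^esub> word v = word (u @ v)"
  by (simp_all add: free_algebra_def word_def)

lemma lookup_word: "Poly_Mapping.lookup (word w) u = of_bool (w = u)"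
  by (simp add: word_def lookup_single when_def)

lemma word_power: "word [i] [^]\<^bsub>free_algebra\<^esub> n = (word (replicate n i) :: _ \<Rightarrow>\<^sub>0 'k::field)"
proof -
  interpret ring "free_algebra :: ('k, _) module" by (rule ring_free_algebra)
  show ?thesis by (induction n) (simp_all add: replicate_append_same)
qed

text \<open>A factorization of a power of \<open>i\<close> in the free monoid consists of two powers of \<open>i\<close>, so the
  coefficients of these powers multiply like those of polynomials in one variable.\<close>

lemma lookup_mult_replicate:
  fixes p q :: "'i list \<Rightarrow>\<^sub>0 'k::field"
  shows "Poly_Mapping.lookup (p \<otimes>\<^bsub>free_algebra\<^esub> q) (replicate n i) =
     (\<Sum>k\<le>n. Poly_Mapping.lookup p (replicate k i) * Poly_Mapping.lookup q (replicate (n - k) i))"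
proof -
  have "of_bool (u @ v = replicate n i) =
      (\<Sum>k\<le>n. of_bool (u = replicate k i) * of_bool (v = replicate (n - k) i) :: 'k)" for u v :: "'i list"
  proof (cases "u @ v = replicate n i")
    case True
    then have "set u \<subseteq> {i}" "set v \<subseteq> {i}"
      by (auto dest!: arg_cong[of _ _ set] split: if_splits)
    then obtain a b where uv: "u = replicate a i" "v = replicate b i"
      by (metis replicate_length_same singletonD subsetD)
    with True have n: "n = a + b" by (auto dest!: arg_cong[of _ _ length])
    have "(\<Sum>k\<le>n. of_bool (u = replicate k i) * of_bool (v = replicate (n - k) i) :: 'k) =
        (\<Sum>k\<le>n. if k = a then 1 else 0)"
      using n unfolding uv by (intro sum.cong) auto
    then show ?thesis using True n by simp
  next
    case False
    then have "\<not> (u = replicate k i \<and> v = replicate (n - k) i)" if "k \<le> n" for k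
      using that by (auto simp: replicate_add[symmetric])
    then show ?thesis using False by (auto intro!: sum.neutral[symmetric])
  qed
  then show ?thesis
    unfolding lookup_eq_lin_ext free_algebra_def by (intro lin_ext_mult_split) simp
qed

text \<open>This is the preimage of \<open>(x\<^sup>N)\<close> under the map from the free algebra to \<open>\<Bbbk>[x]\<close> that sends the
  generator \<open>i\<close> to \<open>x\<close> and the others to \<open>0\<close>.\<close>

lemma ideal_no_small_powers:
  "ideal {p :: 'i list \<Rightarrow>\<^sub>0 'k::field. \<forall>n<N. Poly_Mapping.lookup p (replicate n i) = 0} free_algebra"
    (is "ideal ?K _")
proof (rule idealI)
  interpret ring "free_algebra :: ('k, 'i list \<Rightarrow>\<^sub>0 'k) module" by (rule ring_free_algebra)
  show "ring (free_algebra :: ('k, 'i list \<Rightarrow>\<^sub>0 'k) module)" by (rule ring_free_algebra)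
  have neg: "\<ominus>\<^bsub>free_algebra\<^esub> p = - p" for p :: "'i list \<Rightarrow>\<^sub>0 'k"
    unfolding free_algebra_def by simp
  have "0 \<in> ?K" by simp
  then have "?K \<noteq> {}" by blast
  then show "subgroup ?K (add_monoid free_algebra)"
    by (intro add.subgroupI) (simp_all add: lookup_add neg)
qed (auto simp: lookup_mult_replicate)

text \<open>Braid words have length at least two and alternate between distinct letters, so they are not
  powers of one generator. Among the relators \<open>s\<^sub>j\<^bsup>d j\<^esup>\<close> only \<open>s\<^sub>i\<^bsup>d i\<^esup>\<close> is a power of \<open>s\<^sub>i\<close>, and its
  exponent is too large; positivity of the exponents excludes the relator \<open>s\<^sub>j\<^sup>0 = 1\<close>.\<close>

lemma relators_no_small_powers:
  assumes "coxeter_matrix m" "J\<^sub>0 \<subseteq> braid_pairs m" "\<forall>i. 0 < d i"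
  shows "nil_hecke_relators m d J\<^sub>0 \<subseteq>
    {p. \<forall>n<d i. Poly_Mapping.lookup p (replicate n i) = (0 :: 'k::field)}"
proof -
  have braid: "Poly_Mapping.lookup (braid_word m a b) (replicate n i) = (0 :: 'k)"
    if "{a, b} \<in> braid_pairs m" for a b n
  proof -
    have "a \<noteq> b" "m a b < \<infinity>"
      using that assms(1) by (auto simp: braid_pairs_def coxeter_matrix_def doubleton_eq_iff)
    moreover from this have "2 \<le> m a b" using assms(1) by (simp add: coxeter_matrix_def)
    ultimately have "a \<noteq> b" "m a b < \<infinity>" "2 \<le> m a b" by simp_all
    from \<open>m a b < \<infinity>\<close> obtain l where "m a b = enat l" by auto
    with \<open>2 \<le> m a b\<close> have "m a b = enat l" "2 \<le> l" by (simp_all add: numeral_eq_enat)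
    then obtain k where "the_enat (m a b) = Suc (Suc k)" by (auto dest!: le_Suc_ex)
    with \<open>a \<noteq> b\<close> show ?thesis
      by (cases n; cases "n - 1") (auto simp: braid_word_def lookup_word)
  qed
  show ?thesis
    using assms(2,3)
    by (auto simp: nil_hecke_relators_def word_power lookup_minus braid insert_commute
        lookup_word subset_iff )
qed

locale nil_hecke_data =
  fixes m :: "'i \<Rightarrow> 'i \<Rightarrow> enat" and d :: "'i \<Rightarrow> nat" and J\<^sub>0 :: "'i set set"
    and A :: "('k::field, ('i list \<Rightarrow>\<^sub>0 'k) set) module" (structure)
    and J :: "('i list \<Rightarrow>\<^sub>0 'k) set"
  assumes coxeter: "coxeter_matrix m" and J\<^sub>0: "J\<^sub>0 \<subseteq> braid_pairs m" and d_pos: "\<forall>i. 0 < d i"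
  defines "A \<equiv> nil_hecke m d J\<^sub>0" and "J \<equiv> Idl\<^bsub>free_algebra\<^esub> (nil_hecke_relators m d J\<^sub>0)"
begin

lemma A_eq: "A = quot_algebra free_algebra J"
  by (simp add: A_def J_def nil_hecke_def)

lemma ideal_J: "ideal J free_algebra"
  unfolding J_def by (rule ring.genideal_ideal[OF ring_free_algebra]) simp

lemma relators_in_J: "nil_hecke_relators m d J\<^sub>0 \<subseteq> J"
  unfolding J_def by (rule ring.genideal_self[OF ring_free_algebra]) simp

abbreviation coset :: "('i list \<Rightarrow>\<^sub>0 'k) \<Rightarrow> ('i list \<Rightarrow>\<^sub>0 'k) set" where
  "coset p \<equiv> J +>\<^bsub>free_algebra\<^esub> p"

lemma coset_carrier: "coset p \<in> carrier A"
  unfolding A_eq by (rule coset_in_quot_algebra[OF ideal_J]) simp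

lemma eq_coset: "X \<in> carrier A \<Longrightarrow> p \<in> X \<Longrightarrow> X = coset p"
  unfolding A_eq by (rule quot_algebra_eq_coset[OF ideal_J])

lemma in_coset: "p \<in> coset p"
proof -
  interpret ideal J "free_algebra :: ('k, 'i list \<Rightarrow>\<^sub>0 'k) module" by (rule ideal_J)
  show ?thesis by (rule a_rcos_self) simp
qed

text \<open>The coefficient of \<open>s\<^sub>i\<^sup>n\<close> in an arbitrary representative. It does not depend on the choice
  for \<open>n < d i\<close>, where it is the coefficient of \<open>x\<^sup>n\<close> of an algebra map to \<open>\<Bbbk>[x]/(x\<^bsup>d i\<^esup>)\<close>.\<close>

definition power_coeff :: "'i \<Rightarrow> nat \<Rightarrow> ('i list \<Rightarrow>\<^sub>0 'k) set \<Rightarrow> 'k" where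
  "power_coeff i n X = Poly_Mapping.lookup (SOME p. p \<in> X) (replicate n i)"

lemma power_coeff_coset:
  assumes "n < d i"
  shows "power_coeff i n (coset p) = Poly_Mapping.lookup p (replicate n i)"
proof -
  have "J \<subseteq> {p. \<forall>n<d i. Poly_Mapping.lookup p (replicate n i) = 0}"
    unfolding J_def
    by (rule ring.genideal_minimal[OF ring_free_algebra ideal_no_small_powers
          relators_no_small_powers[OF coxeter J\<^sub>0 d_pos]])
  moreover have "(SOME q. q \<in> coset p) \<in> coset p" by (rule someI) (rule in_coset)
  ultimately show ?thesis
    using assms by (auto simp: power_coeff_def a_r_coset_def' lookup_add)
qed

lemma coset_hom: "coset \<in> ring_hom free_algebra A"
  unfolding A_eq by (rule coset_ring_hom[OF ideal_J])

lemma coset_simps: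
  "coset p \<oplus> coset q = coset (p + q)" "coset p \<otimes> coset q = coset (p \<otimes>\<^bsub>free_algebra\<^esub> q)"
  "coset (word []) = \<one>"
  using coset_hom by (simp_all add: ring_hom_def)

end

text \<open>The algebra laws of the quotient are assumed here, not derived: they are part of any bialgebra
  structure on it.\<close>

locale nil_hecke_algebra = nil_hecke_data m d J\<^sub>0 A J + k_algebra A
  for m :: "'i \<Rightarrow> 'i \<Rightarrow> enat" and d J\<^sub>0
    and A :: "('k::field, ('i list \<Rightarrow>\<^sub>0 'k) set) module" (structure) and J
begin

text \<open>The scalar multiple of a coset is defined as a union of cosets; closedness of the carrier forces
  this union to be a single coset, which is identified by one of its elements.\<close>

lemma smult_coset: "c \<odot> coset p = coset (Poly_Mapping.map ((*) c) p)"
proof (rule eq_coset)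
  show "c \<odot> coset p \<in> carrier A" using vs.smult_closed[of c] coset_carrier by simp
  show "Poly_Mapping.map ((*) c) p \<in> c \<odot> coset p"
    using quot_algebra_smult_rep[OF ideal_J in_coset, of c p] by (simp add: A_eq)
qed

lemma carrierE:
  assumes "X \<in> carrier A"
  obtains p where "X = coset p"
  using assms quot_algebra_ex_rep[OF ideal_J] eq_coset unfolding A_eq by blast

lemma power_coeff_linear: "n < d i \<Longrightarrow> linear_functional A (power_coeff i n)"
  unfolding linear_functional_def
  by (auto elim!: carrierE simp: coset_simps smult_coset power_coeff_coset lookup_add lookup_scale)

lemma power_coeff_mult:
  assumes "n < d i" "X \<in> carrier A" "Y \<in> carrier A"
  shows "power_coeff i n (X \<otimes> Y) = (\<Sum>k\<le>n. power_coeff i k X * power_coeff i (n - k) Y)"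
  using assms
  by (auto elim!: carrierE simp: coset_simps power_coeff_coset lookup_mult_replicate)

lemma power_coeff_generator: "n < d i \<Longrightarrow> power_coeff i n (coset (word [i])) = of_bool (n = 1)"
  by (cases n) (auto simp: power_coeff_coset lookup_word)

lemma generator_nilpotent: "coset (word [i]) [^] d i = \<zero>"
proof -
  interpret F: ring "free_algebra :: ('k, 'i list \<Rightarrow>\<^sub>0 'k) module" by (rule ring_free_algebra)
  have "coset (word [i]) [^] n = coset (word (replicate n i))" for n
    by (induction n) (simp_all add: coset_simps replicate_append_same)
  moreover have "word (replicate (d i) i) \<in> J"
    using relators_in_J by (auto simp: nil_hecke_relators_def word_power)
  then have "\<zero> = coset (word (replicate (d i) i))"
    by (intro eq_coset) (simp, simp add: A_eq quot_algebra_simps)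
  ultimately show ?thesis by simp
qed

text \<open>Nilpotent elements of \<open>A\<close> go to \<open>0\<close> in a field. Hence \<open>\<epsilon>\<close> vanishes on all nonempty words and
  reads off the coefficient of the empty word, which is the zeroth power of any generator.\<close>

lemma counit_eq_power_coeff:
  assumes \<epsilon>: "\<epsilon> \<in> algebra_hom A ground" and X: "X \<in> carrier A"
  shows "\<epsilon> X = power_coeff i 0 X"
proof -
  have \<epsilon>_add: "\<epsilon> (Y \<oplus> Z) = \<epsilon> Y + \<epsilon> Z" and \<epsilon>_mult: "\<epsilon> (Y \<otimes> Z) = \<epsilon> Y * \<epsilon> Z"
    if "Y \<in> carrier A" "Z \<in> carrier A" for Y Z
    using \<epsilon> that by (auto simp: algebra_hom_def ring_hom_def)
  have \<epsilon>_smult: "\<epsilon> (c \<odot> Y) = c * \<epsilon> Y" if "Y \<in> carrier A" for Y c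
    using \<epsilon> that by (auto simp: algebra_hom_def)
  have \<epsilon>_one: "\<epsilon> \<one> = 1" using \<epsilon> by (auto simp: algebra_hom_def ring_hom_def)
  have \<epsilon>0: "\<epsilon> \<zero> = 0" using \<epsilon>_smult[of \<zero> 0] vs.smult_l_null[of \<zero>] by simp
  have gen: "\<epsilon> (coset (word [j])) = 0" for j
  proof -
    have "\<epsilon> (coset (word [j]) [^] n) = \<epsilon> (coset (word [j])) ^ n" for n :: nat
      by (induction n) (simp_all add: \<epsilon>_one \<epsilon>_mult coset_carrier)
    from this[of "d j"] show ?thesis using \<epsilon>0 by (simp add: generator_nilpotent)
  qed
  have words: "\<epsilon> (coset (word w)) = of_bool (w = [])" for w
  proof (cases w)
    case Nil
    then show ?thesis using \<epsilon>_one by (simp add: coset_simps)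
  next
    case (Cons j u)
    then have "coset (word w) = coset (word [j]) \<otimes> coset (word u)" by (simp add: coset_simps)
    then show ?thesis using Cons gen by (simp add: \<epsilon>_mult coset_carrier)
  qed
  obtain p where p: "X = coset p" using X by (rule carrierE)
  have "\<epsilon> (coset p) = lin_ext (\<lambda>w. \<epsilon> (coset (word w))) p"
    unfolding word_def
  proof (rule lin_ext_unique)
    fix q r show "\<epsilon> (coset (q + r)) = \<epsilon> (coset q) + \<epsilon> (coset r)"
      by (simp add: \<epsilon>_add coset_carrier flip: coset_simps)
  next
    fix w :: "'i list" and c :: 'k
    have "coset (Poly_Mapping.single w c) = c \<odot> coset (Poly_Mapping.single w 1)"
      by (simp add: smult_coset)
    then show "\<epsilon> (coset (Poly_Mapping.single w c)) = c * \<epsilon> (coset (Poly_Mapping.single w 1))"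
      by (simp add: \<epsilon>_smult coset_carrier)
  qed
  also have "\<dots> = power_coeff i 0 (coset p)"
    using d_pos by (simp add: words power_coeff_coset lookup_eq_lin_ext)
  finally show ?thesis by (simp add: p)
qed

end

theorem proposition2p1:
  fixes m :: "'i::finite \<Rightarrow> 'i \<Rightarrow> enat"
    and d :: "'i \<Rightarrow> nat"
    and J\<^sub>0 :: "'i set set"
  assumes "coxeter_matrix m"
    and "\<forall>i. 2 \<le> d i"
    and "J\<^sub>0 \<subseteq> braid_pairs m"
  shows "\<not> (\<exists>\<Delta> \<epsilon>. bialgebra
    (nil_hecke m d J\<^sub>0 :: ('k::field_char_0, ('i list \<Rightarrow>\<^sub>0 'k) set) module) \<Delta> \<epsilon>)"
proof
  let ?A = "nil_hecke m d J\<^sub>0 :: ('k, ('i list \<Rightarrow>\<^sub>0 'k) set) module"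
  let ?J = "Idl\<^bsub>free_algebra\<^esub> (nil_hecke_relators m d J\<^sub>0) :: ('i list \<Rightarrow>\<^sub>0 'k) set"
  assume "\<exists>\<Delta> \<epsilon>. bialgebra ?A \<Delta> \<epsilon>"
  then obtain \<Delta> \<epsilon> where B: "bialgebra ?A \<Delta> \<epsilon>" by blast
  interpret B: bialgebra ?A \<Delta> \<epsilon> by (rule B)
  have "\<forall>i. 0 < d i" using assms(2) by (metis gr0I not_numeral_le_zero)
  then interpret N: nil_hecke_algebra m d J\<^sub>0 ?A ?J
    using assms B.k_algebra_axioms
    by (simp add: nil_hecke_algebra_def nil_hecke_data_def)
  fix i :: 'i
  have "N.coset (word [i]) [^]\<^bsub>?A\<^esub> d i \<noteq> \<zero>\<^bsub>?A\<^esub>"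
  proof (rule B.truncated_character_power_nonzero[where c = "N.power_coeff i"])
    show "2 \<le> d i" using assms(2) by simp
    then show "(of_nat (d i) :: 'k) \<noteq> 0" by simp
  qed (simp_all add: N.power_coeff_linear N.power_coeff_mult N.power_coeff_generator
      N.coset_carrier N.counit_eq_power_coeff[OF B.counit_hom, symmetric])
  then show False using N.generator_nilpotent by simp
qed

end
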